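(* For each $\gamma$ with $0<\gamma<1/2$, there exist an analytic self-map $\phi\colon\mathbb{D}\to\mathbb{D}$ such that the composition operator $C_\phi\colon H^2\to H^2$, $f\mapsto f\circ\phi$, is not compact, a weight $w\in H^\infty$ with $w\not\equiv0$, and constants $b>0$, $C>0$ such that $$a_n(M_wC_\phi)\le C\exp(-b\,n^\gamma)\quad\text{for all } n\ge1 .$$ In particular, $M_wC_\phi$ belongs to every Schatten class $S_p(H^2)$, $p>0$.
   Context: $\mathbb{D}$ is the open unit disk, $H^2$ the Hardy space and $H^\infty$ the space of bounded analytic functions on $\mathbb{D}$. $M_wC_\phi$ is the operator $f\mapsto w\,(f\circ\phi)$ on $H^2$. For a bounded operator $T$ on a Hilbert space, $a_n(T)=\inf\{\|T-R\| : \operatorname{rank}R<n\}$ are its approximation numbers. $S_p(H^2)$ is the Schatten class of compact operators $T$ on $H^2$ with $\sum_n s_n(T)^p<\infty$, $s_n$ the singular numbers. *)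

theory Defs
  imports "HOL-Complex_Analysis.Complex_Analysis"
begin

definition taylor_coeff :: "(complex \<Rightarrow> complex) \<Rightarrow> nat \<Rightarrow> complex" where
  "taylor_coeff f n = (deriv ^^ n) f 0 / of_nat (fact n)"

text \<open>The Hardy space H^2 of the unit disk (values outside the disk are irrelevant).\<close>
definition H2 :: "(complex \<Rightarrow> complex) set" where
  "H2 = {f. f holomorphic_on ball 0 1 \<and> summable (\<lambda>n. (cmod (taylor_coeff f n))\<^sup>2)}"

definition h2norm :: "(complex \<Rightarrow> complex) \<Rightarrow> real" where
  "h2norm f = sqrt (\<Sum>n. (cmod (taylor_coeff f n))\<^sup>2)"

definition Hinf :: "(complex \<Rightarrow> complex) set" where
  "Hinf = {w. w holomorphic_on ball 0 1 \<and> bounded (w ` ball 0 1)}"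

text \<open>Operators on H^2 are modelled as maps on functions; only their action on H2 matters.\<close>
type_synonym h2op = "(complex \<Rightarrow> complex) \<Rightarrow> (complex \<Rightarrow> complex)"

definition comp_op :: "(complex \<Rightarrow> complex) \<Rightarrow> h2op" where
  "comp_op \<phi> = (\<lambda>f z. f (\<phi> z))"

definition wcomp_op :: "(complex \<Rightarrow> complex) \<Rightarrow> (complex \<Rightarrow> complex) \<Rightarrow> h2op" where
  "wcomp_op w \<phi> = (\<lambda>f z. w z * f (\<phi> z))"

definition h2_linear :: "h2op \<Rightarrow> bool" where
  "h2_linear T \<longleftrightarrow> (\<forall>f\<in>H2. T f \<in> H2) \<and>
     (\<forall>f\<in>H2. \<forall>g\<in>H2. \<forall>z\<in>ball 0 1. T (\<lambda>x. f x + g x) z = T f z + T g z) \<and>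
     (\<forall>f\<in>H2. \<forall>c. \<forall>z\<in>ball 0 1. T (\<lambda>x. c * f x) z = c * T f z)"

definition h2_bounded :: "h2op \<Rightarrow> bool" where
  "h2_bounded T \<longleftrightarrow> h2_linear T \<and> (\<exists>K. \<forall>f\<in>H2. h2norm (T f) \<le> K * h2norm f)"

definition op_norm :: "h2op \<Rightarrow> real" where
  "op_norm T = (SUP f \<in> {f \<in> H2. h2norm f \<le> 1}. h2norm (T f))"

definition rank_less :: "h2op \<Rightarrow> nat \<Rightarrow> bool" where
  "rank_less R n \<longleftrightarrow> (\<exists>gs. length gs < n \<and> set gs \<subseteq> H2 \<and>
     (\<forall>f\<in>H2. \<exists>c. \<forall>z\<in>ball 0 1. R f z = (\<Sum>i<length gs. c i * (gs ! i) z)))"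

definition approx_num :: "nat \<Rightarrow> h2op \<Rightarrow> real" where
  "approx_num n T = (INF R \<in> {R. h2_bounded R \<and> rank_less R n}. op_norm (\<lambda>f z. T f z - R f z))"

text \<open>Compact operators on H2: bounded, and the image of every bounded sequence has
  an H2-Cauchy (hence convergent, H2 being complete) subsequence.\<close>
definition h2_compact :: "h2op \<Rightarrow> bool" where
  "h2_compact T \<longleftrightarrow> h2_bounded T \<and>
     (\<forall>f :: nat \<Rightarrow> complex \<Rightarrow> complex. (\<forall>k. f k \<in> H2 \<and> h2norm (f k) \<le> 1) \<longrightarrow>
        (\<exists>r :: nat \<Rightarrow> nat. strict_mono r \<and> (\<forall>e>0. \<exists>N. \<forall>m\<ge>N. \<forall>n\<ge>N.
            h2norm (\<lambda>z. T (f (r m)) z - T (f (r n)) z) < e)))"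

text \<open>Schatten class S_p; for compact operators on a Hilbert space the singular numbers
  coincide with the approximation numbers, s_n(T) = a_n(T).\<close>
definition in_Schatten :: "real \<Rightarrow> h2op \<Rightarrow> bool" where
  "in_Schatten p T \<longleftrightarrow> h2_compact T \<and> summable (\<lambda>n. approx_num (Suc n) T powr p)"

end

theory Submission
  imports Defs "HOL-Real_Asymp.Real_Asymp"
begin

text \<open>
  Let \<open>u = 1 - z\<close> and take \<open>\<phi> = 1 - \<delta> (3 u - u powr (1 + \<epsilon>))\<close>, \<open>w = exp (- u powr (- \<alpha>))\<close> with
  \<open>\<alpha> < 1\<close>. Since \<open>\<phi>\<close> has a finite angular derivative at 1, its composition operator is not compact.
  On the other hand \<open>1 - |\<phi>| \<ge> \<kappa> |u| powr (1 + \<epsilon>)\<close>, so balancing the decay of \<open>w\<close> near 1 against that of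
  \<open>\<phi> ^ k\<close> away from 1 gives \<open>|w \<phi> ^ k| \<le> exp (- b k powr \<gamma>)\<close> on the disk with
  \<open>\<gamma> = \<alpha> / (\<alpha> + 1 + \<epsilon>)\<close>, which can be any number below 1/2. Replacing \<open>f\<close> by its Taylor polynomial
  then approximates \<open>w (f \<circ> \<phi>)\<close> uniformly on the disk, hence in H2, by an operator of finite rank.
\<close>

section \<open>The Hardy space\<close>

text \<open>Each summand is \<open>q ^ j\<close> with
  \<open>q = \<omega> ^ a * cnj (\<omega> ^ b)\<close>, an m-th root of unity. Distinct exponents
  below \<open>m\<close> give \<open>q \<noteq> 1\<close>, and then the geometric sum vanishes
  because \<open>q ^ m = 1\<close>.\<close>

lemma sum_roots_of_unity_orthogonal:
  assumes "a < m" "b < m"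
  defines "\<omega> \<equiv> cis (2 * pi / real m)"
  shows "(\<Sum>j<m. (\<omega> ^ j) ^ a * cnj ((\<omega> ^ j) ^ b)) = (if a = b then of_nat m else 0)"
proof -
  have \<omega>: "\<omega> * cnj \<omega> = 1"
    by (simp add: \<omega>_def cis_cnj cis_mult)
  have pw: "\<omega> ^ k = cis (2 * pi * real k / real m)" for k
    unfolding \<omega>_def Complex.DeMoivre by (rule arg_cong[of _ _ cis]) simp
  define q where "q = \<omega> ^ a * cnj (\<omega> ^ b)"
  have "(\<omega> ^ j) ^ a * cnj ((\<omega> ^ j) ^ b) = q ^ j" for j
    by (simp add: q_def power_mult_distrib mult.commute[of j] flip: power_mult)
  then have sum_eq: "(\<Sum>j<m. (\<omega> ^ j) ^ a * cnj ((\<omega> ^ j) ^ b)) = (\<Sum>j<m. q ^ j)"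
    by simp
  show ?thesis
  proof (cases "a = b")
    case True
    then have "q = 1"
      using \<omega> by (simp add: q_def flip: power_mult_distrib)
    then show ?thesis
      using True sum_eq by simp
  next
    case False
    have "\<omega> ^ a \<noteq> \<omega> ^ b"
      using Complex.bij_betw_roots_unity[of m] assms(1,2) False
      by (auto simp: pw bij_betw_def inj_on_def)
    moreover have "q * \<omega> ^ b = \<omega> ^ a"
      using \<omega> by (simp add: q_def mult.assoc mult.commute flip: power_mult_distrib)
    ultimately have "q \<noteq> 1"
      by auto
    have "\<omega> ^ m = 1"
      using assms(1) by (simp add: pw)
    then have "(\<omega> ^ k) ^ m = 1" for k
      by (metis mult.commute power_mult power_one)
    then have "q ^ m = 1"
      by (simp add: q_def power_mult_distrib flip: complex_cnj_power)
    then have "(\<Sum>j<m. q ^ j) = 0"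
      using geometric_sum[OF \<open>q \<noteq> 1\<close>, of m] by simp
    then show ?thesis
      using False sum_eq by simp
  qed
qed

text \<open>By orthogonality, averaging the squared modulus of a polynomial of degree less than
  \<open>m\<close> over the m-th roots of unity gives exactly the sum of its squared coefficient
  moduli, and the average is at most \<open>B\<^sup>2\<close>.\<close>

lemma sum_coeff_sq_le_sup_circle:
  fixes a :: "nat \<Rightarrow> complex"
  assumes "\<And>\<zeta>. cmod \<zeta> = 1 \<Longrightarrow> cmod (\<Sum>n<m. a n * \<zeta> ^ n) \<le> B"
  shows "(\<Sum>n<m. (cmod (a n))\<^sup>2) \<le> B\<^sup>2"
proof (cases "m = 0")
  case False
  define \<omega> where "\<omega> = cis (2 * pi / real m)"
  define p where "p \<zeta> = (\<Sum>n<m. a n * \<zeta> ^ n)" for \<zeta>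
  have "complex_of_real (\<Sum>j<m. (cmod (p (\<omega> ^ j)))\<^sup>2) = (\<Sum>j<m. p (\<omega> ^ j) * cnj (p (\<omega> ^ j)))"
    by (simp add: complex_norm_square[symmetric])
  also have "\<dots> = (\<Sum>j<m. \<Sum>i<m. \<Sum>k<m. (a i * cnj (a k)) * ((\<omega> ^ j) ^ i * cnj ((\<omega> ^ j) ^ k)))"
    by (simp add: p_def sum_product mult_ac)
  also have "\<dots> = (\<Sum>i<m. \<Sum>j<m. \<Sum>k<m. (a i * cnj (a k)) * ((\<omega> ^ j) ^ i * cnj ((\<omega> ^ j) ^ k)))"
    by (rule sum.swap)
  also have "\<dots> = (\<Sum>i<m. \<Sum>k<m. \<Sum>j<m. (a i * cnj (a k)) * ((\<omega> ^ j) ^ i * cnj ((\<omega> ^ j) ^ k)))"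
    by (intro sum.cong refl sum.swap)
  also have "\<dots> = (\<Sum>i<m. \<Sum>k<m. (a i * cnj (a k)) * (if i = k then of_nat m else 0))"
    by (intro sum.cong refl)
       (simp add: sum_roots_of_unity_orthogonal \<omega>_def del: complex_cnj_power flip: sum_distrib_left)
  also have "\<dots> = (\<Sum>i<m. (a i * cnj (a i)) * of_nat m)"
    by (simp add: if_distrib[of "\<lambda>x. _ * x"] sum.delta cong: if_cong)
  also have "\<dots> = complex_of_real (real m * (\<Sum>n<m. (cmod (a n))\<^sup>2))"
    by (simp add: complex_norm_square[symmetric] sum_distrib_left mult.commute)
  finally have "real m * (\<Sum>n<m. (cmod (a n))\<^sup>2) = (\<Sum>j<m. (cmod (p (\<omega> ^ j)))\<^sup>2)"
    unfolding of_real_eq_iff by simp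
  also have "\<dots> \<le> (\<Sum>j<m. B\<^sup>2)"
    using assms by (intro sum_mono power_mono) (auto simp: p_def \<omega>_def norm_power)
  finally show ?thesis
    using False by simp
qed auto

section \<open>Taylor coefficients and norm estimates in H2\<close>

lemma taylor_sums:
  assumes "f holomorphic_on ball 0 1" "z \<in> ball 0 1"
  shows "(\<lambda>n. taylor_coeff f n * z ^ n) sums f z"
  using holomorphic_power_series[OF assms] by (simp add: taylor_coeff_def)

lemma taylor_coeff_eqI:
  assumes "\<And>z. z \<in> ball 0 1 \<Longrightarrow> (\<lambda>n. a n * z ^ n) sums f z"
  shows "taylor_coeff f n = a n"
proof -
  have "eventually (\<lambda>u::complex. u \<in> ball 0 1) (nhds 0)"
    by (intro eventually_nhds_in_open) auto
  then have "f has_fps_expansion Abs_fps a"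
    using assms by (intro has_fps_expansionI) (auto elim!: eventually_mono)
  from fps_nth_fps_expansion[OF this, of n] show ?thesis
    by (simp add: taylor_coeff_def)
qed

lemma taylor_coeff_lincomb:
  assumes "f holomorphic_on ball 0 1" "g holomorphic_on ball 0 1"
    and "\<And>z. z \<in> ball 0 1 \<Longrightarrow> h z = c * f z + d * g z"
  shows "taylor_coeff h n = c * taylor_coeff f n + d * taylor_coeff g n"
proof (rule taylor_coeff_eqI)
  fix z :: complex assume z: "z \<in> ball 0 1"
  show "(\<lambda>n. (c * taylor_coeff f n + d * taylor_coeff g n) * z ^ n) sums h z"
    using sums_add[OF sums_mult[OF taylor_sums[OF assms(1) z], of c]
        sums_mult[OF taylor_sums[OF assms(2) z], of d]] assms(3)[OF z]
    by (simp add: algebra_simps)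
qed

lemma H2_holomorphic: "f \<in> H2 \<Longrightarrow> f holomorphic_on ball 0 1"
  by (simp add: H2_def)

lemma h2norm_nonneg: "f \<in> H2 \<Longrightarrow> 0 \<le> h2norm f"
  by (auto simp: H2_def h2norm_def intro!: suminf_nonneg)

lemma h2norm_sq: "f \<in> H2 \<Longrightarrow> (h2norm f)\<^sup>2 = (\<Sum>n. (cmod (taylor_coeff f n))\<^sup>2)"
  by (auto simp: H2_def h2norm_def intro!: suminf_nonneg)

lemma taylor_coeff_le_h2norm:
  assumes "f \<in> H2"
  shows "cmod (taylor_coeff f n) \<le> h2norm f"
proof (rule power2_le_imp_le)
  have "(\<Sum>i\<in>{n}. (cmod (taylor_coeff f i))\<^sup>2) \<le> (\<Sum>i. (cmod (taylor_coeff f i))\<^sup>2)"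
    using assms by (intro sum_le_suminf) (auto simp: H2_def)
  then show "(cmod (taylor_coeff f n))\<^sup>2 \<le> (h2norm f)\<^sup>2"
    using assms by (simp add: h2norm_sq)
qed (use assms in \<open>rule h2norm_nonneg\<close>)

text \<open>The Taylor polynomials of degree less than \<open>m\<close> are averaged over the \<open>m\<close>-th roots of unity, and
  \<open>m\<close> tends to infinity; this avoids integration over the circle.\<close>
lemma sum_taylor_coeff_sq_le:
  assumes hol: "h holomorphic_on ball 0 1"
    and bd: "\<And>z. z \<in> ball 0 1 \<Longrightarrow> cmod (h z) \<le> B"
    and r: "0 \<le> r" "r < 1"
  shows "(\<Sum>n<N. (cmod (taylor_coeff h n) * r ^ n)\<^sup>2) \<le> B\<^sup>2"
proof -
  define c where "c n = cmod (taylor_coeff h n) * r ^ n" for n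
  \<comment> \<open>Convergence at \<open>(r + 1) / 2\<close>, strictly between \<open>r\<close> and
    1, forces absolute convergence at radius \<open>r\<close>.\<close>
  have "(\<lambda>n. taylor_coeff h n * of_real ((r + 1) / 2) ^ n) sums h (of_real ((r + 1) / 2))"
    using r by (intro taylor_sums[OF hol]) (auto simp: norm_divide simp flip: of_real_add)
  then have "summable (\<lambda>n. cmod (taylor_coeff h n * of_real r ^ n))"
    using r by (intro powser_insidea[of _ "of_real ((r + 1) / 2)"])
      (auto simp: sums_iff norm_divide simp flip: of_real_add)
  then have sm: "summable c"
    using r by (simp add: c_def[abs_def] norm_mult norm_power)
  have circle: "(\<Sum>n<m. (c n)\<^sup>2) \<le> (B + (\<Sum>n. c (n + m)))\<^sup>2" for m
  proof -
    have "(\<Sum>n<m. (cmod (taylor_coeff h n * of_real r ^ n))\<^sup>2) \<le> (B + (\<Sum>n. c (n + m)))\<^sup>2"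
    proof (rule sum_coeff_sq_le_sup_circle)
      fix \<zeta> :: complex assume \<zeta>: "cmod \<zeta> = 1"
      define z where "z = of_real r * \<zeta>"
      have z: "z \<in> ball 0 1"
        using \<zeta> r by (simp add: z_def norm_mult)
      note s = taylor_sums[OF hol z]
      have nc: "cmod (taylor_coeff h n * z ^ n) = c n" for n
        using \<zeta> r by (simp add: c_def z_def norm_mult norm_power)
      have "(\<Sum>n<m. taylor_coeff h n * z ^ n) = h z - (\<Sum>n. taylor_coeff h (n + m) * z ^ (n + m))"
        using suminf_split_initial_segment[of "\<lambda>n. taylor_coeff h n * z ^ n" m] s
        by (simp add: sums_iff)
      moreover have "cmod (\<Sum>n. taylor_coeff h (n + m) * z ^ (n + m)) \<le> (\<Sum>n. c (n + m))"
        using summable_norm[of "\<lambda>n. taylor_coeff h (n + m) * z ^ (n + m)"]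
        unfolding nc using sm by (simp add: summable_iff_shift)
      ultimately have "cmod (\<Sum>n<m. taylor_coeff h n * z ^ n) \<le> B + (\<Sum>n. c (n + m))"
        using bd[OF z] norm_triangle_ineq4[of "h z" "\<Sum>n. taylor_coeff h (n + m) * z ^ (n + m)"] by simp
      then show "cmod (\<Sum>n<m. taylor_coeff h n * of_real r ^ n * \<zeta> ^ n) \<le> B + (\<Sum>n. c (n + m))"
        by (simp add: z_def power_mult_distrib mult.assoc)
    qed
    then show ?thesis
      using r by (simp add: c_def norm_mult norm_power)
  qed
  \<comment> \<open>\<open>N\<close> stays fixed while \<open>m\<close> grows: the first
    \<open>N\<close> terms are dominated by the first \<open>m\<close>, and the tail correction
    tends to 0.\<close>
  have "\<forall>\<^sub>F m in sequentially. (\<Sum>n<N. (c n)\<^sup>2) \<le> (B + (\<Sum>n. c (n + m)))\<^sup>2"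
  proof (rule eventually_sequentiallyI[of N])
    fix m assume "N \<le> m"
    then show "(\<Sum>n<N. (c n)\<^sup>2) \<le> (B + (\<Sum>n. c (n + m)))\<^sup>2"
      by (intro order_trans[OF sum_mono2 circle]) auto
  qed
  moreover have "(\<lambda>m. (B + (\<Sum>n. c (n + m)))\<^sup>2) \<longlonglongrightarrow> (B + 0)\<^sup>2"
    by (intro tendsto_intros suminf_exist_split2[OF sm])
  ultimately have "(\<Sum>n<N. (c n)\<^sup>2) \<le> (B + 0)\<^sup>2"
    by (intro tendsto_lowerbound) auto
  then show ?thesis
    by (simp add: c_def)
qed

text \<open>The estimate for fixed \<open>r < 1\<close> survives the limit of \<open>r\<close> to 1
  because each partial sum involves finitely many coefficients. This is the bridge from uniform
  bounds on the disk to norm bounds in H2.\<close>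

lemma bounded_imp_H2:
  assumes hol: "h holomorphic_on ball 0 1"
    and bd: "\<And>z. z \<in> ball 0 1 \<Longrightarrow> cmod (h z) \<le> B"
  shows "h \<in> H2" and "h2norm h \<le> B"
proof -
  have B: "0 \<le> B"
    using order_trans[OF norm_ge_zero bd[of 0]] by simp
  have part: "(\<Sum>n<N. (cmod (taylor_coeff h n))\<^sup>2) \<le> B\<^sup>2" for N
  proof (rule tendsto_upperbound)
    show "((\<lambda>r. \<Sum>n<N. (cmod (taylor_coeff h n) * r ^ n)\<^sup>2) \<longlongrightarrow>
        (\<Sum>n<N. (cmod (taylor_coeff h n))\<^sup>2)) (at_left (1::real))"
      by (auto intro!: tendsto_eq_intros)
    show "\<forall>\<^sub>F r in at_left 1. (\<Sum>n<N. (cmod (taylor_coeff h n) * r ^ n)\<^sup>2) \<le> B\<^sup>2"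
      using eventually_at_left_real[of 0 1]
      by (rule eventually_mono) (auto intro: sum_taylor_coeff_sq_le[OF hol bd])
  qed auto
  have sm: "summable (\<lambda>n. (cmod (taylor_coeff h n))\<^sup>2)"
    by (rule summableI_nonneg_bounded[OF _ part]) auto
  then show "h \<in> H2"
    using hol by (simp add: H2_def)
  show "h2norm h \<le> B"
    unfolding h2norm_def using suminf_le_const[OF sm part] B by (simp add: real_le_lsqrt)
qed

text \<open>The factors 2 come from |x - y|^2 <= 2 |x|^2 + 2 |y|^2, applied to each coefficient. The
  norm bound serves to show that a supremum is finite, so crude constants suffice.\<close>

lemma H2_diff:
  assumes "f \<in> H2" "g \<in> H2"
  shows "(\<lambda>z. f z - g z) \<in> H2"
    and "h2norm (\<lambda>z. f z - g z) \<le> 2 * h2norm f + 2 * h2norm g"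
proof -
  let ?F = "\<lambda>n. (cmod (taylor_coeff f n))\<^sup>2" and ?G = "\<lambda>n. (cmod (taylor_coeff g n))\<^sup>2"
  have holf: "f holomorphic_on ball 0 1" and holg: "g holomorphic_on ball 0 1"
    and sf: "summable ?F" and sg: "summable ?G"
    using assms by (auto simp: H2_def)
  have tc: "taylor_coeff (\<lambda>z. f z - g z) n = taylor_coeff f n - taylor_coeff g n" for n
    using taylor_coeff_lincomb[OF holf holg, of "\<lambda>z. f z - g z" 1 "-1"] by simp
  have le: "(cmod (taylor_coeff (\<lambda>z. f z - g z) n))\<^sup>2 \<le> 2 * ?F n + 2 * ?G n" for n
  proof -
    have "(cmod (taylor_coeff (\<lambda>z. f z - g z) n))\<^sup>2
        \<le> (cmod (taylor_coeff f n) + cmod (taylor_coeff g n))\<^sup>2"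
      unfolding tc by (intro power_mono norm_triangle_ineq4) auto
    also have "\<dots> \<le> 2 * ?F n + 2 * ?G n"
      using zero_le_power2[of "cmod (taylor_coeff f n) - cmod (taylor_coeff g n)"]
      by (simp add: power2_eq_square algebra_simps)
    finally show ?thesis .
  qed
  have s2: "summable (\<lambda>n. 2 * ?F n + 2 * ?G n)"
    by (intro summable_add summable_mult sf sg)
  have s: "summable (\<lambda>n. (cmod (taylor_coeff (\<lambda>z. f z - g z) n))\<^sup>2)"
    by (rule summable_comparison_test[OF _ s2]) (use le in auto)
  then show H: "(\<lambda>z. f z - g z) \<in> H2"
    using holf holg by (auto simp: H2_def intro: holomorphic_intros)
  have "(h2norm (\<lambda>z. f z - g z))\<^sup>2 \<le> (\<Sum>n. 2 * ?F n + 2 * ?G n)"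
    unfolding h2norm_sq[OF H] by (rule suminf_le[OF le s s2])
  also have "\<dots> = 2 * (h2norm f)\<^sup>2 + 2 * (h2norm g)\<^sup>2"
    using suminf_add[OF summable_mult[OF sf, of 2] summable_mult[OF sg, of 2]]
    by (simp add: suminf_mult sf sg h2norm_sq assms)
  also have "\<dots> \<le> (2 * h2norm f + 2 * h2norm g)\<^sup>2"
    using mult_nonneg_nonneg[OF h2norm_nonneg[OF assms(1)] h2norm_nonneg[OF assms(2)]]
      zero_le_power2[of "h2norm f"] zero_le_power2[of "h2norm g"]
    unfolding power2_eq_square by (simp add: algebra_simps)
  finally show "h2norm (\<lambda>z. f z - g z) \<le> 2 * h2norm f + 2 * h2norm g"
    by (rule power2_le_imp_le) (simp add: h2norm_nonneg assms)
qed

text \<open>Cauchy-Schwarz for the coefficients of \<open>g\<close> against the powers of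
  \<open>z\<close>, whose squared moduli sum to \<open>1 / (1 - (cmod z)\<^sup>2)\<close>. A value
  at one point thus bounds the norm from below.\<close>

lemma H2_point_evaluation:
  assumes g: "g \<in> H2" and z: "z \<in> ball 0 1"
  shows "cmod (g z) * sqrt (1 - (cmod z)\<^sup>2) \<le> h2norm g"
proof -
  define q where "q = (cmod z)\<^sup>2"
  have q: "0 \<le> q" "q < 1"
    using z by (auto simp: q_def power_less_one_iff abs_square_less_1)
  have le: "cmod (\<Sum>n<N. taylor_coeff g n * z ^ n) \<le> h2norm g * sqrt (1 / (1 - q))" for N
  proof -
    have "cmod (\<Sum>n<N. taylor_coeff g n * z ^ n) \<le> (\<Sum>n<N. cmod (taylor_coeff g n) * cmod z ^ n)"
      by (rule order_trans[OF norm_sum]) (simp add: norm_mult norm_power)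
    moreover have "(\<Sum>n<N. cmod (taylor_coeff g n) * cmod z ^ n)\<^sup>2
        \<le> (\<Sum>n<N. (cmod (taylor_coeff g n))\<^sup>2) * (\<Sum>n<N. (cmod z ^ n)\<^sup>2)"
      by (rule Cauchy_Schwarz_ineq_sum)
    moreover have "(\<Sum>n<N. (cmod (taylor_coeff g n))\<^sup>2) \<le> (h2norm g)\<^sup>2"
      unfolding h2norm_sq[OF g] using g by (intro sum_le_suminf) (auto simp: H2_def)
    moreover have "(\<Sum>n<N. (cmod z ^ n)\<^sup>2) \<le> 1 / (1 - q)"
    proof -
      have "(\<Sum>n<N. q ^ n) \<le> (\<Sum>n. q ^ n)"
        using q by (intro sum_le_suminf) (auto intro: summable_geometric)
      also have "\<dots> = 1 / (1 - q)"
        using q by (intro suminf_geometric) auto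
      finally show ?thesis
        by (simp add: q_def mult.commute flip: power_mult)
    qed
    ultimately have "(\<Sum>n<N. cmod (taylor_coeff g n) * cmod z ^ n)\<^sup>2 \<le> (h2norm g)\<^sup>2 * (1 / (1 - q))"
      by (elim order_trans[OF _ mult_mono]) (auto intro: sum_nonneg)
    also have "\<dots> = (h2norm g * sqrt (1 / (1 - q)))\<^sup>2"
      using q by (simp add: power_mult_distrib)
    finally have "(\<Sum>n<N. cmod (taylor_coeff g n) * cmod z ^ n) \<le> h2norm g * sqrt (1 / (1 - q))"
      using q by (intro power2_le_imp_le[OF _ mult_nonneg_nonneg]) (auto simp: h2norm_nonneg g)
    then show ?thesis
      using \<open>cmod (\<Sum>n<N. taylor_coeff g n * z ^ n) \<le> _\<close> by linarith
  qed
  have "(\<lambda>N. cmod (\<Sum>n<N. taylor_coeff g n * z ^ n)) \<longlonglongrightarrow> cmod (g z)"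
    using taylor_sums[OF H2_holomorphic[OF g] z] by (intro tendsto_norm) (simp add: sums_def)
  then have "cmod (g z) \<le> h2norm g * sqrt (1 / (1 - q))"
    using le by (intro LIMSEQ_le_const2) auto
  then show ?thesis
    using q by (simp add: q_def real_sqrt_divide field_simps)
qed


section \<open>Operators on the Hardy space\<close>

lemma zero_in_H2: "(\<lambda>z. 0) \<in> H2" "h2norm (\<lambda>z. 0) \<le> 0"
  using bounded_imp_H2[of "\<lambda>z. 0" 0] by auto

lemma op_norm_le:
  assumes "\<And>f. f \<in> H2 \<Longrightarrow> h2norm f \<le> 1 \<Longrightarrow> h2norm (T f) \<le> B"
  shows "op_norm T \<le> B"
  unfolding op_norm_def
proof (rule cSUP_least)
  show "{f \<in> H2. h2norm f \<le> 1} \<noteq> {}"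
    using zero_in_H2 by fastforce
qed (use assms in auto)

text \<open>\<open>op_norm\<close> is a real supremum, so its values must be shown to be bounded
  above before the value at the zero function bounds it from below. The result provides the lower
  bound that the real infimum in \<open>approx_num\<close> requires.\<close>

lemma op_norm_diff_nonneg:
  assumes "h2_bounded T" "h2_bounded R"
  shows "0 \<le> op_norm (\<lambda>f z. T f z - R f z)"
proof -
  obtain K L where K: "\<And>f. f \<in> H2 \<Longrightarrow> h2norm (T f) \<le> K * h2norm f"
    and L: "\<And>f. f \<in> H2 \<Longrightarrow> h2norm (R f) \<le> L * h2norm f"
    using assms unfolding h2_bounded_def by metis
  have T: "T f \<in> H2" and R: "R f \<in> H2" if "f \<in> H2" for f
    using assms that by (auto simp: h2_bounded_def h2_linear_def)
  have le: "h2norm (\<lambda>z. T f z - R f z) \<le> 2 * \<bar>K\<bar> + 2 * \<bar>L\<bar>" if f: "f \<in> H2" "h2norm f \<le> 1" for f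
  proof -
    have abs: "C * h2norm f \<le> \<bar>C\<bar>" for C
      using mult_mono[OF abs_ge_self[of C] f(2)] h2norm_nonneg[OF f(1)] by simp
    then show ?thesis
      using H2_diff(2)[OF T[OF f(1)] R[OF f(1)]] K[OF f(1)] L[OF f(1)]
        abs[of K] abs[of L] by linarith
  qed
  have "0 \<le> h2norm (\<lambda>z. T (\<lambda>z. 0) z - R (\<lambda>z. 0) z)"
    by (intro h2norm_nonneg H2_diff(1) T R zero_in_H2)
  also have "\<dots> \<le> op_norm (\<lambda>f z. T f z - R f z)"
    unfolding op_norm_def using zero_in_H2 le
    by (intro cSUP_upper bdd_aboveI2[where M = "2 * \<bar>K\<bar> + 2 * \<bar>L\<bar>"]) auto
  finally show ?thesis .
qed

lemma approx_num_le:
  assumes "h2_bounded T" "h2_bounded R" "rank_less R n"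
    and "op_norm (\<lambda>f z. T f z - R f z) \<le> B"
  shows "approx_num n T \<le> B"
  unfolding approx_num_def
  using assms op_norm_diff_nonneg
  by (intro cINF_lower2[where x = R] bdd_belowI2[where m = 0]) auto

text \<open>The operator \<open>R\<close> witnesses that the infimum runs over a nonempty
  set.\<close>

lemma approx_num_nonneg:
  assumes "h2_bounded T" "h2_bounded R" "rank_less R n"
  shows "0 \<le> approx_num n T"
  unfolding approx_num_def
  by (rule cINF_greatest) (use assms op_norm_diff_nonneg in auto)

section \<open>Weighted composition operators with a summable majorant\<close>

text \<open>The locale isolates what the upper bounds for the weighted operator rest on: a summable
  sequence \<open>M\<close> dominating \<open>w * \<phi> ^ k\<close> uniformly on the disk.\<close>

locale dominated_weight =
  fixes w \<phi> :: "complex \<Rightarrow> complex" and M :: "nat \<Rightarrow> real"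
  assumes hol_w: "w holomorphic_on ball 0 1"
    and hol_\<phi>: "\<phi> holomorphic_on ball 0 1"
    and \<phi>_self: "z \<in> ball 0 1 \<Longrightarrow> \<phi> z \<in> ball 0 1"
    and summable_M: "summable M"
    and w_\<phi>_le: "z \<in> ball 0 1 \<Longrightarrow> cmod (w z * \<phi> z ^ k) \<le> M k"
begin

text \<open>This is \<open>wcomp_op w \<phi>\<close> applied to the Taylor polynomial of
  \<open>f\<close> of degree less than \<open>N\<close>.\<close>

definition trunc :: "nat \<Rightarrow> h2op" where
  "trunc N f z = (\<Sum>k<N. taylor_coeff f k * (w z * \<phi> z ^ k))"

lemma M_nonneg: "0 \<le> M k"
  using order_trans[OF norm_ge_zero w_\<phi>_le[of 0]] by simp

lemma hol_wcomp: "f holomorphic_on ball 0 1 \<Longrightarrow> wcomp_op w \<phi> f holomorphic_on ball 0 1"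
  unfolding wcomp_op_def
  using holomorphic_on_compose_gen[OF hol_\<phi>, of f "ball 0 1"] hol_w \<phi>_self
  by (auto simp: o_def image_subset_iff intro!: holomorphic_intros)

lemma hol_trunc: "trunc N f holomorphic_on ball 0 1"
  unfolding trunc_def[abs_def] by (intro holomorphic_intros hol_w hol_\<phi>)

text \<open>Expanding \<open>f\<close> at \<open>\<phi> z\<close> leaves the terms of index at least
  \<open>N\<close>, each at most \<open>K * M k\<close>. The coefficients are merely bounded; all
  the decay comes from \<open>M\<close>.\<close>

lemma wcomp_minus_trunc_le:
  assumes f: "f holomorphic_on ball 0 1" and K: "\<And>k. cmod (taylor_coeff f k) \<le> K"
    and z: "z \<in> ball 0 1"
  shows "cmod (wcomp_op w \<phi> f z - trunc N f z) \<le> K * (\<Sum>k. M (k + N))"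
proof -
  let ?a = "\<lambda>k. taylor_coeff f k * (w z * \<phi> z ^ k)"
  have "(\<lambda>k. w z * (taylor_coeff f k * \<phi> z ^ k)) sums (w z * f (\<phi> z))"
    by (intro sums_mult taylor_sums[OF f] \<phi>_self z)
  then have s: "?a sums wcomp_op w \<phi> f z"
    by (simp add: wcomp_op_def mult_ac)
  have le: "cmod (?a k) \<le> K * M k" for k
    unfolding norm_mult[of "taylor_coeff f k"] using order_trans[OF norm_ge_zero K]
    by (intro mult_mono K w_\<phi>_le z) auto
  have sM: "summable (\<lambda>k. M (k + N))"
    using summable_M by (simp add: summable_iff_shift)
  have "wcomp_op w \<phi> f z - trunc N f z = (\<Sum>k. ?a (k + N))"
    using suminf_split_initial_segment[of ?a N] s by (simp add: sums_iff trunc_def)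
  also have "cmod \<dots> \<le> (\<Sum>k. K * M (k + N))"
    by (intro norm_suminf_le le summable_mult sM)
  finally show ?thesis
    by (simp only: suminf_mult[OF sM])
qed

lemma trunc_le:
  assumes "\<And>k. cmod (taylor_coeff f k) \<le> K" "z \<in> ball 0 1"
  shows "cmod (trunc N f z) \<le> K * (\<Sum>k<N. M k)"
proof -
  have "cmod (taylor_coeff f k * (w z * \<phi> z ^ k)) \<le> K * M k" for k
    unfolding norm_mult[of "taylor_coeff f k"] using order_trans[OF norm_ge_zero assms(1)]
    by (intro mult_mono assms w_\<phi>_le) auto
  then show ?thesis
    unfolding trunc_def sum_distrib_left by (intro sum_norm_le)
qed

lemma trunc_bounded: "h2_bounded (trunc N)"
proof -
  have "trunc N f \<in> H2 \<and> h2norm (trunc N f) \<le> (\<Sum>k<N. M k) * h2norm f" if "f \<in> H2" for f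
    using bounded_imp_H2[OF hol_trunc trunc_le[OF taylor_coeff_le_h2norm[OF that]]]
    by (auto simp: mult.commute)
  moreover have "trunc N (\<lambda>x. f x + g x) z = trunc N f z + trunc N g z" if "f \<in> H2" "g \<in> H2" for f g z
    using taylor_coeff_lincomb[OF that[THEN H2_holomorphic], of "\<lambda>x. f x + g x" 1 1]
    by (simp add: trunc_def algebra_simps sum.distrib)
  moreover have "trunc N (\<lambda>x. c * f x) z = c * trunc N f z" if "f \<in> H2" for f c z
    using taylor_coeff_lincomb[OF that[THEN H2_holomorphic] that[THEN H2_holomorphic],
        of "\<lambda>x. c * f x" c 0]
    by (simp add: trunc_def sum_distrib_left mult_ac)
  ultimately show ?thesis
    unfolding h2_bounded_def h2_linear_def by simp blast
qed

text \<open>The range lies in the span of the \<open>N\<close> functions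
  \<open>w * \<phi> ^ k\<close> with \<open>k < N\<close>; the strict inequality in
  \<open>rank_less\<close> shifts the index to \<open>Suc N\<close>.\<close>

lemma trunc_rank: "rank_less (trunc N) (Suc N)"
proof -
  define gs where "gs = map (\<lambda>k z. w z * \<phi> z ^ k) [0..<N]"
  have "(\<lambda>z. w z * \<phi> z ^ k) \<in> H2" for k
    by (rule bounded_imp_H2(1)[OF _ w_\<phi>_le]) (auto intro!: holomorphic_intros hol_w hol_\<phi>)
  then have "length gs < Suc N" "set gs \<subseteq> H2"
    by (auto simp: gs_def)
  moreover have "\<forall>z\<in>ball 0 1. trunc N f z = (\<Sum>i<length gs. taylor_coeff f i * (gs ! i) z)" for f
    by (simp add: gs_def trunc_def)
  ultimately show ?thesis
    unfolding rank_less_def by blast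
qed

lemma wcomp_bounded: "h2_bounded (wcomp_op w \<phi>)"
proof -
  have "wcomp_op w \<phi> f \<in> H2 \<and> h2norm (wcomp_op w \<phi> f) \<le> (\<Sum>k. M k) * h2norm f"
    if f: "f \<in> H2" for f
  proof -
    \<comment> \<open>For \<open>N = 0\<close> the truncation is zero, so the remainder estimate
      bounds the operator itself.\<close>
    have "cmod (wcomp_op w \<phi> f z) \<le> h2norm f * (\<Sum>k. M k)" if "z \<in> ball 0 1" for z
      using wcomp_minus_trunc_le[OF H2_holomorphic[OF f] taylor_coeff_le_h2norm[OF f] that, of 0]
      by (simp add: trunc_def)
    from bounded_imp_H2[OF hol_wcomp[OF H2_holomorphic[OF f]] this] show ?thesis
      by (simp add: mult.commute)
  qed
  then show ?thesis
    unfolding h2_bounded_def h2_linear_def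
    by (intro conjI exI[of _ "\<Sum>k. M k"]) (simp_all add: wcomp_op_def algebra_simps)
qed

lemma approx_num_wcomp_le: "approx_num (Suc N) (wcomp_op w \<phi>) \<le> (\<Sum>k. M (k + N))"
proof (rule approx_num_le[OF wcomp_bounded trunc_bounded trunc_rank op_norm_le])
  fix f assume f: "f \<in> H2" "h2norm f \<le> 1"
  note hol = H2_holomorphic[OF f(1)]
  have "cmod (taylor_coeff f k) \<le> 1" for k
    using taylor_coeff_le_h2norm[OF f(1), of k] f(2) by linarith
  from bounded_imp_H2(2)[OF _ wcomp_minus_trunc_le[OF hol this]] hol_wcomp[OF hol] hol_trunc
  show "h2norm (\<lambda>z. wcomp_op w \<phi> f z - trunc N f z) \<le> (\<Sum>k. M (k + N))"
    by (simp add: holomorphic_on_diff)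
qed

lemma approx_num_wcomp_nonneg: "0 \<le> approx_num (Suc N) (wcomp_op w \<phi>)"
  by (rule approx_num_nonneg[OF wcomp_bounded trunc_bounded trunc_rank])

text \<open>The tails are small uniformly over the unit ball, and the remaining sum involves
  finitely many coefficients, so coefficientwise convergence can control it.\<close>

lemma wcomp_diff_norm_le:
  assumes f: "f \<in> H2" "h2norm f \<le> 1" and g: "g \<in> H2" "h2norm g \<le> 1"
  shows "h2norm (\<lambda>z. wcomp_op w \<phi> f z - wcomp_op w \<phi> g z)
    \<le> 2 * (\<Sum>k. M (k + N)) + (\<Sum>k<N. cmod (taylor_coeff f k - taylor_coeff g k) * M k)"
proof (rule bounded_imp_H2(2))
  note hol = f(1)[THEN H2_holomorphic] g(1)[THEN H2_holomorphic]
  show "(\<lambda>z. wcomp_op w \<phi> f z - wcomp_op w \<phi> g z) holomorphic_on ball 0 1"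
    by (intro holomorphic_on_diff hol_wcomp hol)
  fix z :: complex assume z: "z \<in> ball 0 1"
  have "cmod (taylor_coeff f k) \<le> 1" "cmod (taylor_coeff g k) \<le> 1" for k
    using taylor_coeff_le_h2norm[OF f(1), of k] taylor_coeff_le_h2norm[OF g(1), of k] f(2) g(2)
    by linarith+
  note tails = wcomp_minus_trunc_le[OF hol(1) this(1) z, of N] wcomp_minus_trunc_le[OF hol(2) this(2) z, of N]
  have "cmod ((taylor_coeff f k - taylor_coeff g k) * (w z * \<phi> z ^ k))
      \<le> cmod (taylor_coeff f k - taylor_coeff g k) * M k" for k
    unfolding norm_mult[of "taylor_coeff f k - _"] by (intro mult_left_mono w_\<phi>_le z) auto
  then have "cmod (\<Sum>k<N. (taylor_coeff f k - taylor_coeff g k) * (w z * \<phi> z ^ k))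
      \<le> (\<Sum>k<N. cmod (taylor_coeff f k - taylor_coeff g k) * M k)"
    by (intro sum_norm_le)
  then have "cmod (trunc N f z - trunc N g z)
      \<le> (\<Sum>k<N. cmod (taylor_coeff f k - taylor_coeff g k) * M k)"
    by (simp add: trunc_def left_diff_distrib sum_subtractf)
  moreover have "cmod (wcomp_op w \<phi> f z - wcomp_op w \<phi> g z)
      \<le> cmod (wcomp_op w \<phi> f z - trunc N f z) + cmod (trunc N f z - trunc N g z)
        + cmod (wcomp_op w \<phi> g z - trunc N g z)"
    by norm
  ultimately show "cmod (wcomp_op w \<phi> f z - wcomp_op w \<phi> g z)
    \<le> 2 * (\<Sum>k. M (k + N)) + (\<Sum>k<N. cmod (taylor_coeff f k - taylor_coeff g k) * M k)"
    using tails by linarith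
qed

text \<open>The Taylor coefficients of functions in the unit ball are bounded by 1, so a diagonal
  subsequence converges in every coefficient, and along it the images are Cauchy in norm.\<close>

lemma wcomp_compact: "h2_compact (wcomp_op w \<phi>)"
  unfolding h2_compact_def
proof (intro conjI allI impI)
  show "h2_bounded (wcomp_op w \<phi>)"
    by (rule wcomp_bounded)
  fix f :: "nat \<Rightarrow> complex \<Rightarrow> complex"
  assume f: "\<forall>k. f k \<in> H2 \<and> h2norm (f k) \<le> 1"
  have "cmod (taylor_coeff (f n) k) \<le> 1" for n k
    using f taylor_coeff_le_h2norm[of "f n" k] by (meson order_trans)
  then obtain r where r: "strict_mono (r :: nat \<Rightarrow> nat)"
    and conv: "\<And>k. k \<in> UNIV \<Longrightarrow> \<exists>l. (\<lambda>n. taylor_coeff (f (r n)) k) \<longlonglongrightarrow> l"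
    by (rule function_convergent_subsequence
        [where S = UNIV and f = "\<lambda>n. taylor_coeff (f n)" and M = 1, OF countableI_type]) blast
  from conv obtain l where l: "\<And>k. (\<lambda>n. taylor_coeff (f (r n)) k) \<longlonglongrightarrow> l k"
    by (metis UNIV_I)
  have "\<exists>n0. \<forall>m\<ge>n0. \<forall>n\<ge>n0.
      h2norm (\<lambda>z. wcomp_op w \<phi> (f (r m)) z - wcomp_op w \<phi> (f (r n)) z) < e" if e: "e > 0" for e
  proof -
    \<comment> \<open>\<open>N\<close> is fixed first, making the two tails contribute less than
      \<open>e / 2\<close>; then \<open>n0\<close> makes the finite head less than
      \<open>e / 2\<close>.\<close>
    have "(\<lambda>N. \<Sum>k. M (k + N)) \<longlonglongrightarrow> 0"
      by (rule suminf_exist_split2[OF summable_M])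
    then have "\<forall>\<^sub>F N in sequentially. (\<Sum>k. M (k + N)) < e / 4"
      using e by (intro order_tendstoD) auto
    then obtain N where N: "(\<Sum>k. M (k + N)) < e / 4"
      by (auto simp: eventually_sequentially)
    have "(\<lambda>n. \<Sum>k<N. cmod (taylor_coeff (f (r n)) k - l k) * M k) \<longlonglongrightarrow> (\<Sum>k<N. cmod (l k - l k) * M k)"
      by (intro tendsto_intros l)
    then have "\<forall>\<^sub>F n in sequentially. (\<Sum>k<N. cmod (taylor_coeff (f (r n)) k - l k) * M k) < e / 4"
      using e by (intro order_tendstoD) auto
    then obtain n0 where n0: "\<And>n. n \<ge> n0 \<Longrightarrow> (\<Sum>k<N. cmod (taylor_coeff (f (r n)) k - l k) * M k) < e / 4"
      by (auto simp: eventually_sequentially)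
    have "h2norm (\<lambda>z. wcomp_op w \<phi> (f (r m)) z - wcomp_op w \<phi> (f (r n)) z) < e"
      if mn: "m \<ge> n0" "n \<ge> n0" for m n
    proof -
      have "(\<Sum>k<N. cmod (taylor_coeff (f (r m)) k - taylor_coeff (f (r n)) k) * M k)
          \<le> (\<Sum>k<N. cmod (taylor_coeff (f (r m)) k - l k) * M k + cmod (taylor_coeff (f (r n)) k - l k) * M k)"
      proof (rule sum_mono)
        fix k
        have "cmod (taylor_coeff (f (r m)) k - taylor_coeff (f (r n)) k)
            \<le> cmod (taylor_coeff (f (r m)) k - l k) + cmod (taylor_coeff (f (r n)) k - l k)"
          by norm
        from mult_right_mono[OF this M_nonneg[of k]]
        show "cmod (taylor_coeff (f (r m)) k - taylor_coeff (f (r n)) k) * M k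
            \<le> cmod (taylor_coeff (f (r m)) k - l k) * M k + cmod (taylor_coeff (f (r n)) k - l k) * M k"
          by (simp add: distrib_right)
      qed
      also have "\<dots> < e / 2"
        using n0[OF mn(1)] n0[OF mn(2)] by (simp add: sum.distrib)
      finally show ?thesis
        using wcomp_diff_norm_le[of "f (r m)" "f (r n)" N] f[rule_format] N by simp
    qed
    then show ?thesis
      by blast
  qed
  then show "\<exists>r. strict_mono (r :: nat \<Rightarrow> nat) \<and> (\<forall>e>0. \<exists>n0. \<forall>m\<ge>n0. \<forall>n\<ge>n0.
      h2norm (\<lambda>z. wcomp_op w \<phi> (f (r m)) z - wcomp_op w \<phi> (f (r n)) z) < e)"
    by (intro exI[of _ r] conjI r allI impI)
qed

end

section \<open>Noncompactness of composition operators through reproducing kernels\<close>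

text \<open>The squared moduli of the coefficients form a geometric series with sum 1. The value at
  \<open>a\<close> blows up as \<open>a\<close> approaches the circle, while each fixed kernel is
  bounded on the disk; this contrast rules out compactness.\<close>

lemma cauchy_kernel_H2:
  assumes a: "cmod a < 1"
  defines "k \<equiv> (\<lambda>z. of_real (sqrt (1 - (cmod a)\<^sup>2)) / (1 - cnj a * z))"
  shows "k \<in> H2" "h2norm k \<le> 1"
    and "k a = of_real (1 / sqrt (1 - (cmod a)\<^sup>2))"
    and "z \<in> ball 0 1 \<Longrightarrow> cmod (k z) \<le> 1 / (1 - cmod a)"
proof -
  define q where "q = (cmod a)\<^sup>2"
  have q: "0 \<le> q" "q < 1"
    using a by (auto simp: q_def power_less_one_iff abs_square_less_1)
  have lt: "cmod (cnj a * z) < 1" and nz: "1 - cnj a * z \<noteq> 0" if "z \<in> ball 0 1" for z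
  proof -
    show *: "cmod (cnj a * z) < 1"
      using a that mult_strict_mono[of "cmod a" 1 "cmod z" 1] by (simp add: norm_mult)
    show "1 - cnj a * z \<noteq> 0"
      using * by auto
  qed
  have tc: "taylor_coeff k n = of_real (sqrt (1 - q)) * cnj a ^ n" for n
  proof (rule taylor_coeff_eqI)
    fix z :: complex assume z: "z \<in> ball 0 1"
    have "(\<lambda>n. of_real (sqrt (1 - q)) * (cnj a * z) ^ n) sums (of_real (sqrt (1 - q)) * (1 / (1 - cnj a * z)))"
      by (intro sums_mult geometric_sums lt z)
    then show "(\<lambda>n. of_real (sqrt (1 - q)) * cnj a ^ n * z ^ n) sums k z"
      by (simp add: k_def q_def power_mult_distrib mult.assoc)
  qed
  have "(cmod (taylor_coeff k n))\<^sup>2 = (1 - q) * q ^ n" for n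
    using q by (simp add: tc norm_mult norm_power power_mult_distrib) (simp add: q_def mult.commute flip: power_mult)
  moreover have "(\<lambda>n. (1 - q) * q ^ n) sums ((1 - q) * (1 / (1 - q)))"
    using q by (intro sums_mult geometric_sums) auto
  ultimately have s: "(\<lambda>n. (cmod (taylor_coeff k n))\<^sup>2) sums 1"
    using q by simp
  have "k holomorphic_on ball 0 1"
    unfolding k_def using nz by (intro holomorphic_intros) auto
  then show "k \<in> H2" "h2norm k \<le> 1"
    using s by (auto simp: H2_def h2norm_def sums_iff)
  have "k a = of_real (sqrt (1 - q) / (1 - q))"
    by (simp add: k_def q_def mult.commute flip: complex_norm_square)
  also have "sqrt (1 - q) / (1 - q) = 1 / sqrt (1 - q)"
    using q by (simp add: field_simps)
  finally show "k a = of_real (1 / sqrt (1 - (cmod a)\<^sup>2))"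
    by (simp add: q_def)
  assume z: "z \<in> ball 0 1"
  have "1 - cmod a \<le> 1 - cmod (cnj a * z)"
    using z mult_left_le[of "cmod z" "cmod a"] by (simp add: norm_mult)
  also have "\<dots> \<le> cmod (1 - cnj a * z)"
    using norm_triangle_ineq2[of 1 "cnj a * z"] by simp
  finally have "sqrt (1 - q) / cmod (1 - cnj a * z) \<le> 1 / (1 - cmod a)"
    using a q by (intro frac_le) auto
  then show "cmod (k z) \<le> 1 / (1 - cmod a)"
    using q by (simp add: k_def q_def norm_divide)
qed

text \<open>The test functions are the normalised reproducing kernels at the points \<open>\<phi> (x n)\<close>;
  evaluating at \<open>x n\<close> separates their images under the composition operator.\<close>
lemma comp_op_not_compact:
  assumes hol: "\<phi> holomorphic_on ball 0 1" and self: "\<phi> ` ball 0 1 \<subseteq> ball 0 1"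
    and x: "\<And>n. x n \<in> ball 0 1" and lim: "(\<lambda>n. cmod (x n)) \<longlonglongrightarrow> 1"
    and K: "K > 0" "\<And>n. 1 - (cmod (\<phi> (x n)))\<^sup>2 \<le> K * (1 - (cmod (x n))\<^sup>2)"
  shows "\<not> h2_compact (comp_op \<phi>)"
proof
  assume comp: "h2_compact (comp_op \<phi>)"
  define a where "a n = \<phi> (x n)" for n
  define k where "k n = (\<lambda>z. of_real (sqrt (1 - (cmod (a n))\<^sup>2)) / (1 - cnj (a n) * z))" for n
  define \<rho> where "\<rho> n = sqrt (1 - (cmod (x n))\<^sup>2)" for n
  have a: "cmod (a n) < 1" for n
    using self x by (auto simp: a_def image_subset_iff)
  have ker: "k n \<in> H2" "h2norm (k n) \<le> 1"
      "k n (a n) = of_real (1 / sqrt (1 - (cmod (a n))\<^sup>2))"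
      "z \<in> ball 0 1 \<Longrightarrow> cmod (k n z) \<le> 1 / (1 - cmod (a n))" for n z
    using cauchy_kernel_H2[OF a[of n]] unfolding k_def by blast+
  obtain r :: "nat \<Rightarrow> nat" where r: "strict_mono r"
    and cauchy: "\<And>e. e > 0 \<Longrightarrow> \<exists>N. \<forall>m\<ge>N. \<forall>n\<ge>N.
        h2norm (\<lambda>z. comp_op \<phi> (k (r m)) z - comp_op \<phi> (k (r n)) z) < e"
    using comp[unfolded h2_compact_def, THEN conjunct2, THEN spec, of k, THEN mp] ker(1,2) by metis
  have mem: "comp_op \<phi> (k n) \<in> H2" for n
    using comp ker(1) by (auto simp: h2_compact_def h2_bounded_def h2_linear_def)
  \<comment> \<open>The threshold is half of \<open>1 / sqrt K\<close>, the separation that point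
    evaluation yields in the limit.\<close>
  obtain N where N: "\<And>m n. m \<ge> N \<Longrightarrow> n \<ge> N \<Longrightarrow>
      h2norm (\<lambda>z. comp_op \<phi> (k (r m)) z - comp_op \<phi> (k (r n)) z) < 1 / (2 * sqrt K)"
    using cauchy[of "1 / (2 * sqrt K)"] K(1) by auto
  \<comment> \<open>One kernel, of index \<open>r N\<close>, is kept fixed; its bound
    \<open>B\<close> on the disk is later multiplied by \<open>\<rho> (r n)\<close>, which tends to
    0.\<close>
  define B where "B = 1 / (1 - cmod (a (r N)))"
  have low: "1 / sqrt K - B * \<rho> (r n) \<le> 1 / (2 * sqrt K)" if "n \<ge> N" for n
  proof -
    have \<rho>: "0 \<le> \<rho> (r n)"
      using x[of "r n"] by (simp add: \<rho>_def abs_square_le_1)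
    have pos: "0 < 1 - (cmod (a (r n)))\<^sup>2"
      using a[of "r n"] by (simp add: abs_square_less_1)
    have "sqrt (1 - (cmod (a (r n)))\<^sup>2) \<le> sqrt K * \<rho> (r n)"
      unfolding \<rho>_def a_def real_sqrt_mult[symmetric] using K(2) by (intro real_sqrt_le_mono)
    then have "1 / sqrt K \<le> cmod (k (r n) (a (r n))) * \<rho> (r n)"
      unfolding ker(3) norm_of_real using pos K(1) by (simp add: field_simps)
    moreover have "cmod (k (r N) (a (r n))) * \<rho> (r n) \<le> B * \<rho> (r n)"
      unfolding B_def using a by (intro mult_right_mono ker(4) \<rho>) auto
    moreover have "(cmod (k (r n) (a (r n))) - cmod (k (r N) (a (r n)))) * \<rho> (r n)
        \<le> cmod (k (r N) (a (r n)) - k (r n) (a (r n))) * \<rho> (r n)"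
      using norm_triangle_ineq2[of "k (r n) (a (r n))" "k (r N) (a (r n))"]
      by (intro mult_right_mono \<rho>) (simp add: norm_minus_commute)
    moreover have "cmod (k (r N) (a (r n)) - k (r n) (a (r n))) * \<rho> (r n) \<le> 1 / (2 * sqrt K)"
      using H2_point_evaluation[OF H2_diff(1)[OF mem mem] x[of "r n"], of "r N" "r n"] N[of N n] that
      by (simp add: comp_op_def \<rho>_def a_def)
    ultimately show ?thesis
      by (simp add: left_diff_distrib)
  qed
  have "\<rho> \<longlonglongrightarrow> sqrt (1 - 1\<^sup>2)"
    unfolding \<rho>_def[abs_def] by (intro tendsto_intros lim)
  then have "(\<lambda>n. 1 / sqrt K - B * \<rho> (r n)) \<longlonglongrightarrow> 1 / sqrt K - B * 0"
    using LIMSEQ_subseq_LIMSEQ[OF _ r, of \<rho>] by (intro tendsto_intros) (auto simp: o_def)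
  then have "1 / sqrt K - B * 0 \<le> 1 / (2 * sqrt K)"
    using low by (intro LIMSEQ_le_const2) auto
  then show False
    using K(1) by (simp add: field_simps)
qed

section \<open>A symbol tangent to the circle and a weight vanishing at the contact point\<close>

lemma summable_exp_neg_powr:
  assumes "0 < b" "0 < (\<gamma>::real)"
  shows "summable (\<lambda>k. exp (- b * real k powr \<gamma>))"
proof (rule summable_comparison_test_bigo)
  show "summable (\<lambda>k. norm (1 / real k ^ 2))"
    using inverse_power_summable[of 2, where 'a = real] by (simp add: field_simps)
  show "(\<lambda>k. exp (- b * real k powr \<gamma>)) \<in> O(\<lambda>k. 1 / real k ^ 2)"
    using assms by real_asymp
qed

text \<open>Since \<open>(k + N) powr \<gamma>\<close> is at least the average of
  \<open>k powr \<gamma>\<close> and \<open>N powr \<gamma>\<close>, half of the rate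
  \<open>b\<close> makes the series converge and half keeps the decay in \<open>N\<close>. Passing
  from \<open>N\<close> to \<open>Suc N\<close> halves the latter again, whence
  \<open>b / 4\<close>.\<close>

lemma suminf_exp_neg_powr_tail_le:
  assumes b: "0 < b" and \<gamma>: "0 < \<gamma>" "\<gamma> < 1"
  obtains C where "C > 0"
    "\<And>N. (\<Sum>k. exp (- b * real (k + N) powr \<gamma>)) \<le> C * exp (- (b / 4) * real (Suc N) powr \<gamma>)"
proof -
  define S where "S = (\<Sum>k. exp (- (b / 2) * real k powr \<gamma>))"
  have sm: "summable (\<lambda>k. exp (- (b / 2) * real k powr \<gamma>))"
    using b \<gamma> by (intro summable_exp_neg_powr) auto
  have S: "S > 0"
    unfolding S_def using sm by (intro suminf_pos) auto
  have "(\<Sum>k. exp (- b * real (k + N) powr \<gamma>)) \<le> S * exp (b / 4) * exp (- (b / 4) * real (Suc N) powr \<gamma>)" for N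
  proof -
    have Suc_le: "real (Suc N) powr \<gamma> \<le> 2 * real N powr \<gamma> + 1"
    proof (cases "N = 0")
      case False
      then have "real (Suc N) powr \<gamma> \<le> (2 * real N) powr \<gamma>"
        using \<gamma> by (intro powr_mono2) auto
      also have "\<dots> \<le> 2 * real N powr \<gamma>"
        using \<gamma> powr_mono[of \<gamma> 1 "2::real"] by (simp add: powr_mult mult_right_mono)
      finally show ?thesis
        by simp
    qed simp
    have le: "exp (- b * real (k + N) powr \<gamma>)
        \<le> exp (- (b / 2) * real k powr \<gamma>) * (exp (b / 4) * exp (- (b / 4) * real (Suc N) powr \<gamma>))" for k
    proof -
      have "real k powr \<gamma> \<le> real (k + N) powr \<gamma>" "real N powr \<gamma> \<le> real (k + N) powr \<gamma>"
        using \<gamma> by (auto intro!: powr_mono2)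
      then have "real k powr \<gamma> / 2 + (real (Suc N) powr \<gamma> - 1) / 4 \<le> real (k + N) powr \<gamma>"
        using Suc_le by argo
      from mult_left_mono[OF this, of b] show ?thesis
        using b by (simp add: field_simps flip: exp_add)
    qed
    have sN: "summable (\<lambda>k. exp (- b * real (k + N) powr \<gamma>))"
      using summable_exp_neg_powr[OF b \<gamma>(1)] summable_iff_shift[of "\<lambda>k. exp (- b * real k powr \<gamma>)" N]
      by blast
    have "(\<Sum>k. exp (- b * real (k + N) powr \<gamma>))
        \<le> (\<Sum>k. exp (- (b / 2) * real k powr \<gamma>) * (exp (b / 4) * exp (- (b / 4) * real (Suc N) powr \<gamma>)))"
      by (intro suminf_le le sN summable_mult2 sm)
    also have "\<dots> = S * (exp (b / 4) * exp (- (b / 4) * real (Suc N) powr \<gamma>))"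
      unfolding S_def using suminf_mult2[OF sm] by simp
    finally show ?thesis
      by (simp only: mult.assoc)
  qed
  then show ?thesis
    using S by (intro that[of "S * exp (b / 4)"]) auto
qed

section \<open>Size of the symbol and of the weight in terms of the distance to 1\<close>

lemma Re_powr_of_real:
  assumes "u \<noteq> 0"
  shows "Re (u powr of_real a) = cmod u powr a * cos (a * Im (Ln u))"
  using assms by (simp add: powr_def Re_exp)

lemma one_minus_ball:
  assumes "z \<in> ball 0 1"
  shows "0 < Re (1 - z)" "1 - z \<noteq> 0" "cmod (1 - z) < 2" "\<bar>Im (Ln (1 - z))\<bar> < pi / 2"
proof -
  show re: "0 < Re (1 - z)"
    using assms abs_Re_le_cmod[of z] by auto
  then show nz: "1 - z \<noteq> 0"
    by auto
  show "cmod (1 - z) < 2"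
    using assms norm_triangle_ineq4[of 1 z] by auto
  show "\<bar>Im (Ln (1 - z))\<bar> < pi / 2"
    using Re_Ln_pos_lt[OF nz] re by simp
qed

text \<open>Each of the two terms on the right alone suffices on one side of the radius where
  \<open>r powr (- \<alpha>) = x * r powr \<beta>\<close>.\<close>
lemma powr_balance:
  fixes r x \<alpha> \<beta> :: real
  assumes r: "0 < r" and x: "0 \<le> x" and "0 < \<alpha>" "0 < \<beta>"
  shows "x powr (\<alpha> / (\<alpha> + \<beta>)) \<le> r powr (- \<alpha>) + x * r powr \<beta>"
proof (cases "x = 0")
  case False
  define s where "s = x powr (- 1 / (\<alpha> + \<beta>))"
  have s: "0 < s"
    using False by (simp add: s_def)
  show ?thesis
  proof (cases "r \<le> s")
    case True
    have "x powr (\<alpha> / (\<alpha> + \<beta>)) = s powr (- \<alpha>)"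
      by (simp add: s_def powr_powr)
    also have "\<dots> \<le> r powr (- \<alpha>)"
      using True r assms by (intro powr_mono2') auto
    finally show ?thesis
      using x by (simp add: add_increasing2)
  next
    case False
    have "\<alpha> / (\<alpha> + \<beta>) = 1 + (- 1 / (\<alpha> + \<beta>)) * \<beta>"
      using assms by (simp add: field_simps)
    then have "x powr (\<alpha> / (\<alpha> + \<beta>)) = x * s powr \<beta>"
      using x \<open>x \<noteq> 0\<close> by (simp only: s_def powr_powr powr_add) simp
    also have "\<dots> \<le> x * r powr \<beta>"
      using False x s assms by (intro mult_left_mono powr_mono2) auto
    finally show ?thesis
      by (simp add: add_increasing)
  qed
qed simp

text \<open>The minimum over a compact interval is attained, and it is positive: at 0 the factor 3/2
  leaves 1/2, and elsewhere \<open>(1 + \<epsilon>) * t\<close> lies in (t, pi], where cosine has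
  dropped strictly below \<open>cos t\<close>.\<close>

lemma cos_gap:
  fixes \<epsilon> :: real
  assumes "0 < \<epsilon>" "\<epsilon> \<le> 1"
  obtains c where "c > 0" "\<And>t. \<bar>t\<bar> \<le> pi / 2 \<Longrightarrow> c \<le> 3 / 2 * cos t - cos ((1 + \<epsilon>) * t)"
proof -
  let ?g = "\<lambda>t. 3 / 2 * cos t - cos ((1 + \<epsilon>) * t)"
  have "continuous_on {0..pi / 2} ?g"
    by (intro continuous_intros)
  then obtain t0 where t0: "t0 \<in> {0..pi / 2}" "\<And>t. t \<in> {0..pi / 2} \<Longrightarrow> ?g t0 \<le> ?g t"
    using continuous_attains_inf[of "{0..pi / 2}" ?g] by auto
  have "?g t0 > 0"
  proof (cases "t0 = 0")
    case False
    then have "0 < t0" "t0 \<le> pi / 2"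
      using t0(1) by auto
    moreover have "(1 + \<epsilon>) * t0 \<le> 2 * (pi / 2)"
      using calculation assms by (intro mult_mono) auto
    ultimately have "cos ((1 + \<epsilon>) * t0) < cos t0" "0 \<le> cos t0"
      using assms by (auto intro!: cos_monotone_0_pi cos_ge_zero)
    then show ?thesis
      by linarith
  qed simp
  moreover have "?g t0 \<le> ?g t" if "\<bar>t\<bar> \<le> pi / 2" for t
    using t0(2)[of "\<bar>t\<bar>"] that by (cases "t \<ge> 0") auto
  ultimately show ?thesis
    by (rule that)
qed

text \<open>With \<open>v = 3 * u - u powr (1 + \<epsilon>)\<close>, both a lower bound for
  \<open>Re v\<close> and an upper bound for |v|^2 are multiples of
  \<open>R = cmod u powr (1 + \<epsilon>)\<close>, so for small \<delta> the linear term of |1 -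
  \<delta> v|^2 beats the quadratic one.\<close>

lemma tangential_self_map:
  fixes \<epsilon> :: real
  assumes \<epsilon>: "0 < \<epsilon>" "\<epsilon> \<le> 1"
  obtains \<delta> \<kappa> where "\<delta> > 0" "\<kappa> > 0"
    "\<And>z. z \<in> ball 0 1 \<Longrightarrow> cmod (1 - of_real \<delta> * (3 * (1 - z) - (1 - z) powr of_real (1 + \<epsilon>)))
        \<le> exp (- \<kappa> * cmod (1 - z) powr (1 + \<epsilon>))"
proof -
  obtain c where c: "c > 0" "\<And>t. \<bar>t\<bar> \<le> pi / 2 \<Longrightarrow> c \<le> 3 / 2 * cos t - cos ((1 + \<epsilon>) * t)"
    using cos_gap[OF \<epsilon>] by blast
  \<comment> \<open>This minimises \<open>- 2 * \<delta> * c + 50 * \<delta>\<^sup>2\<close>, the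
    coefficient of \<open>R\<close> found below; the minimum is
    \<open>- 2 * \<kappa>\<close>.\<close>
  define \<delta> where "\<delta> = c / 50"
  define \<kappa> where "\<kappa> = c\<^sup>2 / 100"
  have \<delta>: "0 < \<delta>" "0 < \<kappa>"
    using c by (auto simp: \<delta>_def \<kappa>_def)
  have "cmod (1 - of_real \<delta> * (3 * (1 - z) - (1 - z) powr of_real (1 + \<epsilon>)))
        \<le> exp (- \<kappa> * cmod (1 - z) powr (1 + \<epsilon>))" if z: "z \<in> ball 0 1" for z
  proof -
    define u where "u = 1 - z"
    define r where "r = cmod u"
    define t where "t = Im (Ln u)"
    define R where "R = r powr (1 + \<epsilon>)"
    define v where "v = 3 * u - u powr of_real (1 + \<epsilon>)"
    have u: "u \<noteq> 0" "r < 2" "\<bar>t\<bar> < pi / 2"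
      using one_minus_ball[OF z] by (auto simp: u_def r_def t_def)
    then have r: "0 < r"
      by (simp add: r_def)
    have R0: "0 < R"
      using r by (simp add: R_def)
    have "r powr \<epsilon> \<le> 2 powr \<epsilon>"
      using r u \<epsilon> by (intro powr_mono2) auto
    also have "\<dots> \<le> 2"
      using powr_mono[of \<epsilon> 1 "2::real"] \<epsilon> by simp
    finally have Rr: "R \<le> 2 * r"
      using r by (simp add: R_def powr_add)
    \<comment> \<open>Here \<open>\<epsilon> \<le> 1\<close> matters: it makes
      \<open>r\<^sup>2\<close> at most a multiple of \<open>R\<close>.\<close>
    have "r powr (1 - \<epsilon>) \<le> 2 powr (1 - \<epsilon>)"
      using r u \<epsilon> by (intro powr_mono2) auto
    also have "\<dots> \<le> 2"
      using powr_mono[of "1 - \<epsilon>" 1 "2::real"] \<epsilon> by simp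
    finally have "R * r powr (1 - \<epsilon>) \<le> R * 2"
      using R0 by (intro mult_left_mono) auto
    then have rR: "r\<^sup>2 \<le> 2 * R"
      using r by (simp add: R_def flip: powr_add)
    have Reu: "Re u = r * cos t"
      using Re_powr_of_real[OF u(1), of 1] u(1) by (simp add: r_def t_def powr_def)
    have cost: "0 \<le> cos t"
      using u(3) by (intro cos_ge_zero) auto
    have "c * R \<le> (3 / 2 * cos t - cos ((1 + \<epsilon>) * t)) * R"
      using u(3) R0 by (intro mult_right_mono c(2)) auto
    also have "\<dots> = 3 / 2 * (R * cos t) - R * cos ((1 + \<epsilon>) * t)"
      by (simp add: algebra_simps)
    \<comment> \<open>The coefficient 3 of the symbol, halved by \<open>R \<le> 2 * r\<close>, is
      the 3/2 of \<open>cos_gap\<close>.\<close>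
    also have "\<dots> \<le> 3 * Re u - R * cos ((1 + \<epsilon>) * t)"
      using mult_right_mono[OF Rr cost] by (simp add: Reu)
    also have "\<dots> = Re v"
      using Re_powr_of_real[OF u(1), of "1 + \<epsilon>"] by (simp add: v_def R_def r_def t_def)
    finally have Rev: "c * R \<le> Re v" .
    have "cmod v \<le> 3 * r + R"
      using norm_triangle_ineq4[of "3 * u" "u powr of_real (1 + \<epsilon>)"]
        norm_powr_real_powr'[of "of_real (1 + \<epsilon>)" u]
      by (simp add: v_def R_def r_def norm_mult)
    also have "\<dots> \<le> 5 * r"
      using Rr by simp
    finally have "(cmod v)\<^sup>2 \<le> (5 * r)\<^sup>2"
      by (intro power_mono) auto
    also have "\<dots> \<le> 50 * R"
      using rR by (simp add: power_mult_distrib)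
    finally have v2: "(cmod v)\<^sup>2 \<le> 50 * R" .
    have "(cmod (1 - of_real \<delta> * v))\<^sup>2 = 1 - 2 * \<delta> * Re v + \<delta>\<^sup>2 * (cmod v)\<^sup>2"
      unfolding cmod_power2 by (simp add: power2_eq_square algebra_simps)
    also have "\<dots> \<le> 1 - 2 * \<delta> * (c * R) + \<delta>\<^sup>2 * (50 * R)"
      using \<delta> by (intro add_mono diff_mono mult_left_mono Rev v2) auto
    also have "\<dots> = 1 + - (2 * \<kappa> * R)"
      by (simp add: \<delta>_def \<kappa>_def power2_eq_square field_simps)
    also have "\<dots> \<le> exp (- (2 * \<kappa> * R))"
      by (rule exp_ge_add_one_self)
    also have "\<dots> = (exp (- \<kappa> * R))\<^sup>2"
      by (simp add: exp_double[symmetric] mult_ac)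
    finally have "cmod (1 - of_real \<delta> * v) \<le> exp (- \<kappa> * R)"
      by (rule power2_le_imp_le) simp
    then show ?thesis
      by (simp add: v_def R_def r_def u_def)
  qed
  with \<delta> show ?thesis
    by (rule that)
qed

text \<open>The argument of \<open>(1 - z) powr (- \<alpha>)\<close> is at most
  \<open>\<alpha> * pi / 2\<close> in modulus, which stays below a right angle because
  \<open>\<alpha> < 1\<close>; hence the real part is comparable to the modulus.\<close>

lemma cmod_exp_neg_powr_le:
  fixes \<alpha> :: real
  assumes \<alpha>: "0 < \<alpha>" "\<alpha> < 1" and z: "z \<in> ball 0 1"
  shows "cmod (exp (- ((1 - z) powr of_real (- \<alpha>))))
    \<le> exp (- cos (\<alpha> * pi / 2) * cmod (1 - z) powr (- \<alpha>))"
proof -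
  let ?t = "Im (Ln (1 - z))"
  have "\<alpha> * \<bar>?t\<bar> \<le> \<alpha> * (pi / 2)" "\<alpha> * (pi / 2) \<le> 1 * pi"
    using one_minus_ball(4)[OF z] \<alpha> by (auto intro!: mult_mono)
  then have "cos (\<alpha> * pi / 2) \<le> cos (\<alpha> * \<bar>?t\<bar>)"
    using \<alpha> by (intro cos_monotone_0_pi_le) auto
  also have "cos (\<alpha> * \<bar>?t\<bar>) = cos (- \<alpha> * ?t)"
    by (cases "?t \<ge> 0") auto
  finally have "cos (\<alpha> * pi / 2) * cmod (1 - z) powr (- \<alpha>) \<le> Re ((1 - z) powr of_real (- \<alpha>))"
    unfolding Re_powr_of_real[OF one_minus_ball(2)[OF z]]
    by (subst mult.commute) (intro mult_left_mono, auto)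
  then show ?thesis
    by simp
qed

section \<open>Choice of the exponents and conclusion\<close>

theorem theorem3p2:
  fixes \<gamma> :: real
  assumes "0 < \<gamma>" and "\<gamma> < 1/2"
  shows "\<exists>\<phi> w b C.
     \<phi> holomorphic_on ball 0 1 \<and> \<phi> ` ball 0 1 \<subseteq> ball 0 1 \<and>
     \<not> h2_compact (comp_op \<phi>) \<and>
     w \<in> Hinf \<and> (\<exists>z\<in>ball 0 1. w z \<noteq> 0) \<and>
     b > 0 \<and> C > 0 \<and>
     (\<forall>n\<ge>1. approx_num n (wcomp_op w \<phi>) \<le> C * exp (- b * real n powr \<gamma>)) \<and>
     (\<forall>p>0. in_Schatten p (wcomp_op w \<phi>))"
proof -
  \<comment> \<open>The exponents solve \<open>\<alpha> / (\<alpha> + (1 + \<epsilon>)) = \<gamma>\<close>; \<open>\<alpha> < 1\<close> is possible because \<open>\<gamma> < 1/2\<close>.\<close>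
  define \<epsilon> where "\<epsilon> = min 1 ((1 - 2 * \<gamma>) / (2 * \<gamma>))"
  define \<alpha> where "\<alpha> = \<gamma> * (1 + \<epsilon>) / (1 - \<gamma>)"
  have \<epsilon>: "0 < \<epsilon>" "\<epsilon> \<le> 1" "\<epsilon> * (2 * \<gamma>) \<le> 1 - 2 * \<gamma>"
    using assms by (auto simp: \<epsilon>_def min_def field_simps)
  \<comment> \<open>\<open>\<alpha> < 1\<close> amounts to
    \<open>\<epsilon> * \<gamma> < 1 - 2 * \<gamma>\<close>, and \<epsilon> was taken at most half
    of that threshold.\<close>
  have "2 * (\<gamma> * (1 + \<epsilon>)) < 2 * (1 - \<gamma>)"
    using \<epsilon>(3) assms by (simp add: algebra_simps)
  then have \<alpha>: "0 < \<alpha>" "\<alpha> < 1"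
    using assms \<epsilon> by (auto simp: \<alpha>_def)
  have sum: "\<alpha> + (1 + \<epsilon>) = (1 + \<epsilon>) / (1 - \<gamma>)"
    using assms by (simp add: \<alpha>_def field_simps)
  have \<gamma>_eq: "\<alpha> / (\<alpha> + (1 + \<epsilon>)) = \<gamma>"
    unfolding sum using assms \<epsilon> by (simp add: \<alpha>_def)
  obtain \<delta> \<kappa> where \<delta>: "\<delta> > 0" and \<kappa>: "\<kappa> > 0" and self:
    "\<And>z. z \<in> ball 0 1 \<Longrightarrow> cmod (1 - of_real \<delta> * (3 * (1 - z) - (1 - z) powr of_real (1 + \<epsilon>)))
        \<le> exp (- \<kappa> * cmod (1 - z) powr (1 + \<epsilon>))"
    using tangential_self_map[OF \<epsilon>(1,2)] by blast
  define \<phi> where "\<phi> z = 1 - of_real \<delta> * (3 * (1 - z) - (1 - z) powr of_real (1 + \<epsilon>))" for z :: complex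
  define w where "w z = exp (- ((1 - z) powr of_real (- \<alpha>)))" for z :: complex
  define \<theta> where "\<theta> = cos (\<alpha> * pi / 2)"
  \<comment> \<open>One constant below both decay rates lets \<open>powr_balance\<close> act on the
    sum of the two exponents.\<close>
  define b where "b = min \<kappa> \<theta>"
  have "\<theta> > 0"
    unfolding \<theta>_def using \<alpha> by (intro cos_gt_zero) auto
  then have b: "0 < b" "b \<le> \<kappa>" "b \<le> \<theta>"
    using \<kappa> by (auto simp: b_def)
  have \<phi>_le: "cmod (\<phi> z) \<le> exp (- \<kappa> * cmod (1 - z) powr (1 + \<epsilon>))" if "z \<in> ball 0 1" for z
    using self[OF that] by (simp add: \<phi>_def)
  have w_le: "cmod (w z) \<le> exp (- \<theta> * cmod (1 - z) powr (- \<alpha>))" if "z \<in> ball 0 1" for z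
    using cmod_exp_neg_powr_le[OF \<alpha> that] by (simp add: w_def \<theta>_def)
  have \<phi>_self: "\<phi> z \<in> ball 0 1" if z: "z \<in> ball 0 1" for z
  proof -
    have "exp (- \<kappa> * cmod (1 - z) powr (1 + \<epsilon>)) < 1"
      using \<kappa> one_minus_ball(2)[OF z] by simp
    then show ?thesis
      using order.strict_trans1[OF \<phi>_le[OF z]] by simp
  qed
  have slit: "1 - z \<notin> \<real>\<^sub>\<le>\<^sub>0" if "z \<in> ball 0 1" for z :: complex
    using one_minus_ball(1)[OF that] by (auto simp: complex_nonpos_Reals_iff)
  have hol: "\<phi> holomorphic_on ball 0 1" "w holomorphic_on ball 0 1"
    unfolding \<phi>_def w_def using slit by (auto intro!: holomorphic_intros)
  have decay: "cmod (w z * \<phi> z ^ k) \<le> exp (- b * real k powr \<gamma>)" if z: "z \<in> ball 0 1" for z k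
  proof -
    define r where "r = cmod (1 - z)"
    have r: "0 < r"
      using one_minus_ball(2)[OF z] by (simp add: r_def)
    have "b * real k powr \<gamma> \<le> b * (r powr (- \<alpha>) + real k * r powr (1 + \<epsilon>))"
      using powr_balance[OF r, of "real k" \<alpha> "1 + \<epsilon>"] \<alpha> \<epsilon> b(1) by (simp add: \<gamma>_eq)
    also have "\<dots> \<le> \<theta> * r powr (- \<alpha>) + \<kappa> * (real k * r powr (1 + \<epsilon>))"
      unfolding distrib_left by (intro add_mono mult_right_mono b) auto
    finally have "exp (- \<theta> * r powr (- \<alpha>) + real k * (- \<kappa> * r powr (1 + \<epsilon>))) \<le> exp (- b * real k powr \<gamma>)"
      by (simp add: algebra_simps)
    moreover have "cmod (w z * \<phi> z ^ k)
        \<le> exp (- \<theta> * r powr (- \<alpha>)) * exp (- \<kappa> * r powr (1 + \<epsilon>)) ^ k"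
      unfolding norm_mult norm_power r_def
      by (intro mult_mono power_mono w_le \<phi>_le z) auto
    ultimately show ?thesis
      unfolding exp_add exp_of_nat_mult by linarith
  qed
  interpret dominated_weight w \<phi> "\<lambda>k. exp (- b * real k powr \<gamma>)"
    by unfold_locales (use hol \<phi>_self decay summable_exp_neg_powr b assms in auto)
  obtain C where C: "C > 0" and tail:
    "\<And>N. (\<Sum>k. exp (- b * real (k + N) powr \<gamma>)) \<le> C * exp (- (b / 4) * real (Suc N) powr \<gamma>)"
    using suminf_exp_neg_powr_tail_le[OF b(1) assms(1)] assms(2) by auto
  have approx: "approx_num (Suc N) (wcomp_op w \<phi>) \<le> C * exp (- (b / 4) * real (Suc N) powr \<gamma>)" for N
    by (rule order_trans[OF approx_num_wcomp_le tail])
  have not_compact: "\<not> h2_compact (comp_op \<phi>)"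
  proof (rule comp_op_not_compact[OF hol(1)])
    \<comment> \<open>The points approach 1 radially; the shift by 2 keeps
      \<open>u = 1 - x n\<close> strictly between 0 and 1.\<close>
    define x where "x n = complex_of_real (1 - 1 / real (n + 2))" for n
    show "\<phi> ` ball 0 1 \<subseteq> ball 0 1"
      using \<phi>_self by blast
    have cmod_x: "cmod (x n) = 1 - 1 / real (n + 2)" for n
      unfolding x_def norm_of_real by (simp add: field_simps)
    show x_ball: "x n \<in> ball 0 1" for n
      by (simp add: cmod_x)
    show "(\<lambda>n. cmod (x n)) \<longlonglongrightarrow> 1"
      unfolding cmod_x by real_asymp
    show "0 < 6 * \<delta>"
      using \<delta> by simp
    fix n
    define u where "u = 1 / real (n + 2)"
    have u: "0 < u" "u < 1" "1 - x n = of_real u"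
      by (auto simp: u_def x_def)
    \<comment> \<open>The power term enters \<phi> with a positive sign, so dropping it bounds the
      real part from below.\<close>
    have "0 \<le> Re (of_real u powr of_real (1 + \<epsilon>))"
      using u by (simp add: Re_powr_of_real Ln_of_real del: of_real_add)
    then have "1 - 3 * \<delta> * u \<le> Re (\<phi> (x n))"
      using \<delta> by (simp add: \<phi>_def u(3) algebra_simps)
    also have "\<dots> \<le> cmod (\<phi> (x n))"
      by (rule complex_Re_le_cmod)
    finally have "1 - cmod (\<phi> (x n)) \<le> 3 * \<delta> * u"
      by simp
    moreover have "cmod (\<phi> (x n)) < 1"
      using \<phi>_self[OF x_ball] by simp
    ultimately have "(1 - cmod (\<phi> (x n))) * (1 + cmod (\<phi> (x n))) \<le> 3 * \<delta> * u * 2"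
      using \<delta> u by (intro mult_mono) auto
    then have "1 - (cmod (\<phi> (x n)))\<^sup>2 \<le> 6 * \<delta> * u"
      by (simp add: power2_eq_square algebra_simps)
    also have "\<dots> \<le> 6 * \<delta> * (1 - (cmod (x n))\<^sup>2)"
    proof (rule mult_left_mono)
      have "u\<^sup>2 \<le> u"
        using u by (simp add: power2_eq_square mult_left_le)
      then show "u \<le> 1 - (cmod (x n))\<^sup>2"
        unfolding cmod_x u_def[symmetric] by (simp add: power2_eq_square algebra_simps)
    qed (use \<delta> in auto)
    finally show "1 - (cmod (\<phi> (x n)))\<^sup>2 \<le> 6 * \<delta> * (1 - (cmod (x n))\<^sup>2)" .
  qed
  \<comment> \<open>For \<open>k = 0\<close> the majorant is 1, since
    \<open>0 powr \<gamma> = 0\<close>.\<close>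
  have "cmod (w z) \<le> 1" if "z \<in> ball 0 1" for z
    using decay[OF that, of 0] by simp
  then have Hinf: "w \<in> Hinf"
    using hol(2) by (auto simp: Hinf_def bounded_iff intro!: exI[of _ 1])
  have Schatten: "in_Schatten p (wcomp_op w \<phi>)" if p: "p > 0" for p
    unfolding in_Schatten_def
  proof
    \<comment> \<open>Raising a stretched exponential to the power \<open>p\<close> only rescales
      its rate, so every \<open>p > 0\<close> works.\<close>
    have "summable (\<lambda>n. C powr p * exp (- (b / 4 * p) * real (Suc n) powr \<gamma>))"
      using b(1) p assms
      by (intro summable_mult summable_exp_neg_powr
          summable_Suc_iff[of "\<lambda>n. exp (- (b / 4 * p) * real n powr \<gamma>)", THEN iffD2]) auto
    moreover have "norm (approx_num (Suc n) (wcomp_op w \<phi>) powr p)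
        \<le> C powr p * exp (- (b / 4 * p) * real (Suc n) powr \<gamma>)" for n
    proof -
      have "approx_num (Suc n) (wcomp_op w \<phi>) powr p \<le> (C * exp (- (b / 4) * real (Suc n) powr \<gamma>)) powr p"
        using p by (intro powr_mono2 approx approx_num_wcomp_nonneg) auto
      also have "\<dots> = C powr p * exp (- (b / 4 * p) * real (Suc n) powr \<gamma>)"
        using C by (simp add: powr_mult powr_def[of "exp _"] mult_ac)
      finally show ?thesis
        by simp
    qed
    ultimately show "summable (\<lambda>n. approx_num (Suc n) (wcomp_op w \<phi>) powr p)"
      by (rule summable_comparison_test')
  qed (rule wcomp_compact)
  have "\<forall>n\<ge>1. approx_num n (wcomp_op w \<phi>) \<le> C * exp (- (b / 4) * real n powr \<gamma>)"
    using approx by (metis One_nat_def Suc_le_D)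
  moreover have "\<exists>z\<in>ball 0 1. w z \<noteq> 0"
    by (intro bexI[of _ 0]) (auto simp: w_def)
  moreover have "\<phi> ` ball 0 1 \<subseteq> ball 0 1" "b / 4 > 0"
    using \<phi>_self b(1) by auto
  ultimately show ?thesis
    using hol(1) not_compact Hinf C Schatten by (intro exI[of _ \<phi>] exI[of _ w] exI[of _ "b / 4"] exI[of _ C]) simp
qed

end
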